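(* Let $(\pi_t)_{t\ge 0}$ be the half-step evolution (product chain) of an alternating Markov chain on $\mathcal{X}\times\mathcal{Y}$, started from an arbitrary probability distribution $\pi_0$ on $\mathcal{X}\times\mathcal{Y}$, let $t_0$ be its burn-in time, and for $t\ge t_0$ let $\ell_t := \log \pi_t \in \mathbb{R}^{\mathcal{T}}$ be the log-likelihood. Then the half-steps $(\pi_t)_{t\ge t_0}$ are given by alternating projections onto $S_1$ and $S_2$ with respect to the reverse Kullback-Leibler divergence; equivalently, the log-likelihoods $(\ell_t)_{t\ge t_0}$ are given by alternating projections onto $\log\widetilde{S}_1$ and $\log\widetilde{S}_2$ with respect to the Bregman divergence $B_{H^*}$. That is, for every $t\ge t_0$ with $t$ even, $$\pi_{t+1} = \arg\min_{\pi\in S_1} D_{\mathrm{RKL}}(\pi,\pi_t) \quad\text{and}\quad \ell_{t+1} = \arg\min_{\ell\in\log\widetilde{S}_1} B_{H^*}(\ell,\ell_t),$$ and for every $t\ge t_0$ with $t$ odd, $$\pi_{t+1} = \arg\min_{\pi\in S_2} D_{\mathrm{RKL}}(\pi,\pi_t) \quad\text{and}\quad \ell_{t+1} = \arg\min_{\ell\in\log\widetilde{S}_2} B_{H^*}(\ell,\ell_t).$$ Here $x=\arg\min_{S} f$ means that $x$ is the unique minimizer of $f$ over $S$.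
   Context: **Alternating Markov chain.** $\mathcal{X},\mathcal{Y}$ are finite sets. Fixed conditional distributions are given: for each $x\in\mathcal{X}$ a probability distribution $P[\cdot\,|x]$ on $\mathcal{Y}$ and for each $y\in\mathcal{Y}$ a probability distribution $P[\cdot\,|y]$ on $\mathcal{X}$. For a distribution $\pi$ on $\mathcal{X}\times\mathcal{Y}$, $\pi_{\mathcal{X}},\pi_{\mathcal{Y}}$ denote its marginals. Starting from a probability distribution $\pi_0$ on $\mathcal{X}\times\mathcal{Y}$, the product chain evolves by $$\pi_{t+1}(x,y)=\begin{cases}P[y|x]\,(\pi_t)_{\mathcal{X}}(x), & t \text{ even},\\ P[x|y]\,(\pi_t)_{\mathcal{Y}}(y), & t\text{ odd}.\end{cases}$$ The primal chain is the Markov chain on $\mathcal{X}$ with transition probabilities $K(x,x')=\sum_{y\in\mathcal{Y}}P[y|x]P[x'|y]$; it is assumed irreducible and aperiodic. **Compatibility and Edwards-Sokal measure.** It is assumed that there exists a probability distribution $\pi$ on $\mathcal{X}\times\mathcal{Y}$ satisfying both, for all $A\subseteq\mathcal{X}$, $B\subseteq\mathcal{Y}$, $$\text{(x)}\quad \pi(A\times B)=\sum_{x\in A}P[B|x]\,\pi_{\mathcal{X}}(x),\qquad \text{(y)}\quad \pi(A\times B)=\sum_{y\in B}P[A|y]\,\pi_{\mathcal{Y}}(y).$$ This measure is unique and is denoted $\pi_{\mathrm{ES}}$ (generalized Edwards-Sokal measure). Its $\mathcal{X}$-marginal has full support on $\mathcal{X}$ (by ergodicity), and $\mathcal{Y}$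 is assumed pruned so that its $\mathcal{Y}$-marginal has full support on $\mathcal{Y}$. Put $\mathcal{T}:=\operatorname{supp}(\pi_{\mathrm{ES}})\subseteq\mathcal{X}\times\mathcal{Y}$, and let $\mathcal{P}(\mathcal{T})$ be the set of probability distributions on $\mathcal{T}$ with full support. **Burn-in time.** $t_0$ is the first half-step such that $\operatorname{supp}(\pi_{t_0})=\mathcal{T}$ for all choices of initial distribution $\pi_0$. It is finite and $\operatorname{supp}(\pi_t)=\mathcal{T}$ for all $t\ge t_0$, so for $t\ge t_0$ one regards $\pi_t\in\mathcal{P}(\mathcal{T})$. **Divergences.** For $p,q\in\mathcal{P}(\mathcal{T})$, $D_{\mathrm{KL}}(p,q)=\sum_{\tau\in\mathcal{T}}p(\tau)\log\frac{p(\tau)}{q(\tau)}$ and $D_{\mathrm{RKL}}(p,q):=D_{\mathrm{KL}}(q,p)$. **Sets.** $S_1:=\{\pi\in\mathcal{P}(\mathcal{T}):\pi\text{ satisfies (x)}\}$ and $S_2:=\{\pi\in\mathcal{P}(\mathcal{T}):\pi\text{ satisfies (y)}\}$. For a convex $S\subseteq\mathcal{P}(\mathcal{T})$, $\widetilde S:=\{\tau\cdot p:\tau\in\mathbb{R}_+,\ p\in S\}\subseteq\mathbb{R}_+^{\mathcal{T}}$, where $\mathbb{R}_+=(0,\infty)$, and $\log\widetilde S\subseteq\mathbb{R}^{\mathcal{T}}$ is the image of $\widetilde S$ under the coordinate-wise logarithm. **Bregman divergence.** $H:\mathbb{R}_+^{\mathcal{T}}\to\mathbb{R}$, $H(\pi)=\sum_{\tau\in\mathcal{T}}(\pi(\tau)\log\pi(\tau)-\pi(\tau))$;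 its Fenchel dual is $H^*(\ell)=\sum_{\tau\in\mathcal{T}}e^{\ell(\tau)}$ on $\mathbb{R}^{\mathcal{T}}$. For differentiable convex $f$, $B_f(p,q):=f(p)-f(q)-\langle\nabla f(q),p-q\rangle$. Thus $B_{H^*}(\ell,m)=\sum_{\tau\in\mathcal{T}}\big(e^{\ell(\tau)}-e^{m(\tau)}-e^{m(\tau)}(\ell(\tau)-m(\tau))\big)$. *)

theory Defs
  imports "HOL-Probability.Probability"
begin

text \<open>
  The finite sets X and Y are finite types \<open>'x\<close> and \<open>'y\<close>. The conditional distribution \<open>P[\<cdot>|x]\<close>
  is \<open>P x :: 'y pmf\<close>, and \<open>P[\<cdot>|y]\<close> is \<open>Q y :: 'x pmf\<close>. Marginals are \<open>map_pmf fst\<close> and \<open>map_pmf snd\<close>,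
  and the support of a distribution is \<open>set_pmf\<close>.
\<close>

section \<open>The alternating chain\<close>

definition half_step_x :: "('x \<Rightarrow> 'y pmf) \<Rightarrow> ('x \<times> 'y) pmf \<Rightarrow> ('x \<times> 'y) pmf" where
  "half_step_x P \<pi> = bind_pmf (map_pmf fst \<pi>) (\<lambda>x. map_pmf (\<lambda>y. (x, y)) (P x))"

definition half_step_y :: "('y \<Rightarrow> 'x pmf) \<Rightarrow> ('x \<times> 'y) pmf \<Rightarrow> ('x \<times> 'y) pmf" where
  "half_step_y Q \<pi> = bind_pmf (map_pmf snd \<pi>) (\<lambda>y. map_pmf (\<lambda>x. (x, y)) (Q y))"

primrec product_chain ::
    "('x \<Rightarrow> 'y pmf) \<Rightarrow> ('y \<Rightarrow> 'x pmf) \<Rightarrow> ('x \<times> 'y) pmf \<Rightarrow> nat \<Rightarrow> ('x \<times> 'y) pmf" where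
  "product_chain P Q \<pi>0 0 = \<pi>0"
| "product_chain P Q \<pi>0 (Suc t) =
     (if even t then half_step_x P (product_chain P Q \<pi>0 t)
      else half_step_y Q (product_chain P Q \<pi>0 t))"

lemma pmf_half_step_x:
  fixes P :: "'x::finite \<Rightarrow> 'y::finite pmf"
  shows "pmf (half_step_x P \<pi>) (x, y) = pmf (P x) y * pmf (map_pmf fst \<pi>) x"
proof -
  have *: "pmf (map_pmf (Pair x') (P x')) (x, y) = (if x' = x then pmf (P x) y else 0)" for x'
    by (auto simp: pmf_map_inj' inj_def intro!: pmf_map_outside)
  show ?thesis
    unfolding half_step_x_def pmf_bind
    by (subst integral_measure_pmf[of UNIV]) (simp_all add: * if_distrib cong: if_cong)
qed

lemma pmf_half_step_y:
  fixes Q :: "'y::finite \<Rightarrow> 'x::finite pmf"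
  shows "pmf (half_step_y Q \<pi>) (x, y) = pmf (Q y) x * pmf (map_pmf snd \<pi>) y"
proof -
  have *: "pmf (map_pmf (\<lambda>x. (x, y')) (Q y')) (x, y) = (if y' = y then pmf (Q y) x else 0)" for y'
  proof (cases "y' = y")
    case True
    have "inj (\<lambda>x. (x, y))" by (auto simp: inj_def)
    then show ?thesis using pmf_map_inj'[of "\<lambda>x. (x, y)" "Q y" x] True by simp
  qed (auto intro!: pmf_map_outside)
  show ?thesis
    unfolding half_step_y_def pmf_bind
    by (subst integral_measure_pmf[of UNIV]) (simp_all add: * if_distrib cong: if_cong)
qed

definition primal_kernel ::
    "('x \<Rightarrow> 'y::finite pmf) \<Rightarrow> ('y \<Rightarrow> 'x pmf) \<Rightarrow> 'x \<Rightarrow> 'x \<Rightarrow> real" where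
  "primal_kernel P Q x x' = (\<Sum>y\<in>UNIV. pmf (P x) y * pmf (Q y) x')"

primrec n_step :: "('x::finite \<Rightarrow> 'x \<Rightarrow> real) \<Rightarrow> nat \<Rightarrow> 'x \<Rightarrow> 'x \<Rightarrow> real" where
  "n_step K 0 x x' = (if x = x' then 1 else 0)"
| "n_step K (Suc n) x x' = (\<Sum>z\<in>UNIV. n_step K n x z * K z x')"

definition irreducible_kernel :: "('x::finite \<Rightarrow> 'x \<Rightarrow> real) \<Rightarrow> bool" where
  "irreducible_kernel K \<longleftrightarrow> (\<forall>x x'. \<exists>n. n_step K n x x' > 0)"

definition aperiodic_kernel :: "('x::finite \<Rightarrow> 'x \<Rightarrow> real) \<Rightarrow> bool" where
  "aperiodic_kernel K \<longleftrightarrow> (\<forall>x. Gcd {n::nat. n > 0 \<and> n_step K n x x > 0} = 1)"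

section \<open>Compatibility and burn-in time\<close>

definition compat_x :: "('x::finite \<Rightarrow> 'y::finite pmf) \<Rightarrow> ('x \<times> 'y) pmf \<Rightarrow> bool" where
  "compat_x P \<pi> \<longleftrightarrow> (\<forall>A B. measure_pmf.prob \<pi> (A \<times> B) =
     (\<Sum>x\<in>A. measure_pmf.prob (P x) B * pmf (map_pmf fst \<pi>) x))"

definition compat_y :: "('y::finite \<Rightarrow> 'x::finite pmf) \<Rightarrow> ('x \<times> 'y) pmf \<Rightarrow> bool" where
  "compat_y Q \<pi> \<longleftrightarrow> (\<forall>A B. measure_pmf.prob \<pi> (A \<times> B) =
     (\<Sum>y\<in>B. measure_pmf.prob (Q y) A * pmf (map_pmf snd \<pi>) y))"

text \<open>\<open>LEAST\<close> is meaningful because, under irreducibility, aperiodicity and compatibility, such a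
  half-step exists.\<close>

definition burn_in_time ::
    "('x \<Rightarrow> 'y pmf) \<Rightarrow> ('y \<Rightarrow> 'x pmf) \<Rightarrow> ('x \<times> 'y) set \<Rightarrow> nat" where
  "burn_in_time P Q T = (LEAST t. \<forall>\<pi>0. set_pmf (product_chain P Q \<pi>0 t) = T)"

section \<open>Distributions with full support and divergences\<close>

definition full_dists :: "'a set \<Rightarrow> 'a pmf set" where
  "full_dists T = {p. set_pmf p = T}"

definition S1 :: "('x::finite \<Rightarrow> 'y::finite pmf) \<Rightarrow> ('x \<times> 'y) set \<Rightarrow> ('x \<times> 'y) pmf set" where
  "S1 P T = {\<pi> \<in> full_dists T. compat_x P \<pi>}"

definition S2 :: "('y::finite \<Rightarrow> 'x::finite pmf) \<Rightarrow> ('x \<times> 'y) set \<Rightarrow> ('x \<times> 'y) pmf set" where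
  "S2 Q T = {\<pi> \<in> full_dists T. compat_y Q \<pi>}"

definition D_KL :: "'a set \<Rightarrow> 'a pmf \<Rightarrow> 'a pmf \<Rightarrow> real" where
  "D_KL T p q = (\<Sum>\<tau>\<in>T. pmf p \<tau> * ln (pmf p \<tau> / pmf q \<tau>))"

lemma D_KL_eq_KL_divergence:
  fixes p q :: "'a::finite pmf"
  assumes "p \<in> full_dists T" "q \<in> full_dists T"
  shows "D_KL T p q = KL_divergence (exp 1) (measure_pmf q) (measure_pmf p)"
proof -
  interpret C: sigma_finite_measure "count_space (UNIV :: 'a set)"
    by (rule sigma_finite_measure_count_space_finite) simp
  have pT: "set_pmf p = T" and qT: "set_pmf q = T"
    using assms by (auto simp: full_dists_def)
  have "KL_divergence (exp 1) (measure_pmf q) (measure_pmf p) =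
      (\<integral>\<tau>. pmf p \<tau> * log (exp 1) (pmf p \<tau> / pmf q \<tau>) \<partial>count_space UNIV)"
    unfolding measure_pmf_eq_density[of p] measure_pmf_eq_density[of q]
    by (rule C.KL_density_density)
       (auto simp: AE_count_space pmf_eq_0_set_pmf pT qT)
  also have "\<dots> = (\<Sum>\<tau>\<in>UNIV. pmf p \<tau> * ln (pmf p \<tau> / pmf q \<tau>))"
    by (simp add: lebesgue_integral_count_space_finite log_def)
  also have "\<dots> = D_KL T p q"
    unfolding D_KL_def
    by (rule sum.mono_neutral_right) (auto simp: pT[symmetric] pmf_eq_0_set_pmf)
  finally show ?thesis by simp
qed

definition D_RKL :: "'a set \<Rightarrow> 'a pmf \<Rightarrow> 'a pmf \<Rightarrow> real" where
  "D_RKL T p q = D_KL T q p"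

section \<open>Vectors indexed by a subset of a type\<close>

text \<open>The space \<open>\<real>\<^sup>T\<close> is represented by \<open>T \<rightarrow>\<^sub>E UNIV\<close>, so that vectors agreeing on \<open>T\<close> are equal;
  the positive orthant is \<open>T \<rightarrow>\<^sub>E {0<..}\<close>.\<close>

definition cone_of :: "'a set \<Rightarrow> 'a pmf set \<Rightarrow> ('a \<Rightarrow> real) set" where
  "cone_of T S = {restrict (\<lambda>\<tau>. c * pmf p \<tau>) T | c p. c > 0 \<and> p \<in> S}"

definition log_vec :: "'a set \<Rightarrow> ('a \<Rightarrow> real) \<Rightarrow> 'a \<Rightarrow> real" where
  "log_vec T v = restrict (\<lambda>\<tau>. ln (v \<tau>)) T"

section \<open>Bregman divergence\<close>

definition partial_deriv :: "(('a \<Rightarrow> real) \<Rightarrow> real) \<Rightarrow> ('a \<Rightarrow> real) \<Rightarrow> 'a \<Rightarrow> real" where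
  "partial_deriv f q \<tau> = deriv (\<lambda>s. f (q(\<tau> := s))) (q \<tau>)"

definition bregman ::
    "'a set \<Rightarrow> (('a \<Rightarrow> real) \<Rightarrow> real) \<Rightarrow> ('a \<Rightarrow> real) \<Rightarrow> ('a \<Rightarrow> real) \<Rightarrow> real" where
  "bregman T f p q = f p - f q - (\<Sum>\<tau>\<in>T. partial_deriv f q \<tau> * (p \<tau> - q \<tau>))"

definition H :: "'a set \<Rightarrow> ('a \<Rightarrow> real) \<Rightarrow> real" where
  "H T v = (\<Sum>\<tau>\<in>T. v \<tau> * ln (v \<tau>) - v \<tau>)"

definition fenchel_dual ::
    "'a set \<Rightarrow> ('a \<Rightarrow> real) set \<Rightarrow> (('a \<Rightarrow> real) \<Rightarrow> real) \<Rightarrow> ('a \<Rightarrow> real) \<Rightarrow> real" where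
  "fenchel_dual T D f l = (SUP v\<in>D. (\<Sum>\<tau>\<in>T. l \<tau> * v \<tau>) - f v)"

definition H_star :: "'a set \<Rightarrow> ('a \<Rightarrow> real) \<Rightarrow> real" where
  "H_star T = fenchel_dual T (T \<rightarrow>\<^sub>E {0<..}) (H T)"

lemma H_star_eq: "H_star T l = (\<Sum>\<tau>\<in>T. exp (l \<tau>))"
proof -
  have ineq: "a * v - (v * ln v - v) \<le> exp a" if "v > 0" for a v :: real
  proof -
    have "1 + (a - ln v) \<le> exp (a - ln v)" by (rule exp_ge_add_one_self)
    also have "\<dots> = exp a / v" using that by (simp add: exp_diff)
    finally show ?thesis using that by (simp add: field_simps)
  qed
  let ?F = "\<lambda>v. (\<Sum>\<tau>\<in>T. l \<tau> * v \<tau>) - H T v"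
  have le: "?F v \<le> (\<Sum>\<tau>\<in>T. exp (l \<tau>))" if "v \<in> T \<rightarrow>\<^sub>E {0<..}" for v
  proof -
    have "?F v = (\<Sum>\<tau>\<in>T. l \<tau> * v \<tau> - (v \<tau> * ln (v \<tau>) - v \<tau>))"
      by (simp add: H_def sum_subtractf)
    also have "\<dots> \<le> (\<Sum>\<tau>\<in>T. exp (l \<tau>))"
      using that by (intro sum_mono ineq) auto
    finally show ?thesis .
  qed
  let ?w = "restrict (\<lambda>\<tau>. exp (l \<tau>)) T"
  have "?F ?w = (\<Sum>\<tau>\<in>T. exp (l \<tau>))"
    by (simp add: H_def flip: sum_subtractf)
  then have w: "(\<Sum>\<tau>\<in>T. exp (l \<tau>)) = ?F ?w" by (rule sym)
  have "?w \<in> T \<rightarrow>\<^sub>E {0<..}" by auto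
  with w have mem: "(\<Sum>\<tau>\<in>T. exp (l \<tau>)) \<in> ?F ` (T \<rightarrow>\<^sub>E {0<..})"
    by (rule image_eqI)
  show ?thesis
    unfolding H_star_def fenchel_dual_def
  proof (rule cSup_eq_maximum[OF mem])
    fix z assume "z \<in> ?F ` (T \<rightarrow>\<^sub>E {0<..})"
    then obtain v where v: "v \<in> T \<rightarrow>\<^sub>E {0<..}" and z: "z = ?F v" by (rule imageE)
    show "z \<le> (\<Sum>\<tau>\<in>T. exp (l \<tau>))" unfolding z by (rule le[OF v])
  qed
qed

lemma bregman_H_star:
  assumes "finite T"
  shows "bregman T (H_star T) l m =
    (\<Sum>\<tau>\<in>T. exp (l \<tau>) - exp (m \<tau>) - exp (m \<tau>) * (l \<tau> - m \<tau>))"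
proof -
  have "partial_deriv (H_star T) m \<tau> = exp (m \<tau>)" if "\<tau> \<in> T" for \<tau>
  proof -
    have eq: "(\<Sum>\<sigma>\<in>T. exp ((m(\<tau> := s)) \<sigma>)) = exp s + (\<Sum>\<sigma>\<in>T - {\<tau>}. exp (m \<sigma>))" for s
      using assms that by (simp add: sum.remove[of T \<tau>])
    have "((\<lambda>s. exp s + (\<Sum>\<sigma>\<in>T - {\<tau>}. exp (m \<sigma>))) has_field_derivative exp (m \<tau>)) (at (m \<tau>))"
      by (auto intro!: derivative_eq_intros)
    then show ?thesis
      unfolding partial_deriv_def H_star_eq eq by (rule DERIV_imp_deriv)
  qed
  then show ?thesis
    by (simp add: bregman_def H_star_eq sum_subtractf)
qed

section \<open>Unique minimizers\<close>

definition unique_argmin :: "('a \<Rightarrow> real) \<Rightarrow> 'a set \<Rightarrow> 'a \<Rightarrow> bool" where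
  "unique_argmin f S x \<longleftrightarrow> is_arg_min f (\<lambda>y. y \<in> S) x \<and>
     (\<forall>y. is_arg_min f (\<lambda>y. y \<in> S) y \<longrightarrow> y = x)"

end

(* A half-step keeps one marginal of its argument q and replaces the conditional law, so along S1
   (or S2) the divergence D_KL(q, p) equals its value at the half-step of q plus the divergence of
   the corresponding marginals of q and p; Gibbs' inequality on the marginals then singles out the
   half-step. On log vectors of cones, the Bregman divergence at log (c p) is
   D_KL(q, p) + (c - 1 - ln c), so its minimum forces c = 1 and the same p. The supports stabilise at T
   because an irreducible aperiodic kernel on a finite set has an everywhere positive power. *)
theory Submission
  imports Defs
begin

section \<open>Positive powers of irreducible aperiodic kernels\<close>

text \<open>Closure under addition makes the elements lie in one residue class structure whose
  finest gap is 1, so two consecutive elements \<open>n\<close> and \<open>n + 1\<close> exist, and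
  their combinations cover everything from \<open>n * n\<close> on. Applied to return times of a
  state.\<close>

lemma add_closed_Gcd_1_cofinite:
  fixes S :: "nat set"
  assumes add: "\<And>a b. a \<in> S \<Longrightarrow> b \<in> S \<Longrightarrow> a + b \<in> S" and "Gcd S = 1"
  shows "\<exists>N. \<forall>n\<ge>N. n \<in> S"
proof -
  have mult: "a + k * b \<in> S" if "a \<in> S" "b \<in> S" for a b k
  proof (induction k)
    case (Suc k)
    have "b + (a + k * b) \<in> S" using add[OF that(2) Suc] .
    then show ?case by (simp add: add.left_commute)
  qed (simp add: that)
  obtain s where s: "s \<in> S" "s > 0"
    using \<open>Gcd S = 1\<close> by (metis Gcd_0_iff gr0I insertI1 singletonD subsetI zero_neq_one)
  \<comment> \<open>The least positive difference of two elements divides every element, so it equals 1.\<close>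
  define D where "D = (\<lambda>d. d > 0 \<and> (\<exists>n\<in>S. n + d \<in> S))"
  have "D s" unfolding D_def using s add by blast
  define d where "d = (LEAST d. D d)"
  have "D d" unfolding d_def by (rule LeastI) fact
  then obtain n where n: "n \<in> S" "n + d \<in> S" and "d > 0" by (auto simp: D_def)
  have "d dvd a" if "a \<in> S" for a
  proof (rule ccontr)
    assume "\<not> d dvd a"
    define q r where "q = a div d" and "r = a mod d"
    have a: "a = q * d + r" by (simp add: q_def r_def)
    \<comment> \<open>These two elements differ by exactly the remainder \<open>r\<close>; a
      positive \<open>r\<close> would be a smaller difference than \<open>d\<close>.\<close>
    have "n + q * (n + d) \<in> S" "(a + n) + q * n \<in> S"
      using mult n add \<open>a \<in> S\<close> by blast+
    moreover have "(a + n) + q * n = (n + q * (n + d)) + r"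
      by (simp add: a algebra_simps)
    moreover have "r > 0" using \<open>\<not> d dvd a\<close> by (simp add: r_def mod_greater_zero_iff_not_dvd)
    ultimately have "D r" unfolding D_def by metis
    then have "d \<le> r" unfolding d_def by (rule Least_le)
    moreover have "r < d" using \<open>d > 0\<close> by (simp add: r_def)
    ultimately show False by simp
  qed
  then have "d dvd Gcd S" by (rule Gcd_greatest)
  with \<open>Gcd S = 1\<close> n have n1: "n + 1 \<in> S" by simp
  have "m \<in> S" if "m \<ge> n * n" for m
  proof (cases "n = 0")
    case True
    with n n1 mult[of 0 1 m] show ?thesis by simp
  next
    case False
    define q r where "q = m div n" and "r = m mod n"
    have m: "m = q * n + r" by (simp add: q_def r_def)
    have "r < n" using False by (simp add: r_def)
    have "n \<le> q" using that False by (simp add: q_def less_eq_div_iff_mult_less_eq)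
    \<comment> \<open>Among the \<open>q\<close> copies of \<open>n\<close>, \<open>r\<close> are
      upgraded to \<open>n + 1\<close> to absorb the remainder; one more is set aside because
      \<open>mult\<close> needs a starting element of \<open>S\<close>. The bound
      \<open>n * n\<close> ensures \<open>r < n \<le> q\<close>, so enough copies exist.\<close>
    define k where "k = q - (r + 1)"
    have "q = k + r + 1" using \<open>r < n\<close> \<open>n \<le> q\<close> by (simp add: k_def)
    then have "m = (n + k * n) + r * (n + 1)" by (simp add: m algebra_simps)
    with mult[OF mult[OF n(1) n(1)] n1] show ?thesis by metis
  qed
  then show ?thesis by blast
qed

section \<open>Walks of a nonnegative kernel\<close>

lemma n_step_nonneg:
  assumes "\<And>x x'. K x x' \<ge> 0"
  shows "n_step K n x x' \<ge> 0"
  by (induction n arbitrary: x') (auto intro!: sum_nonneg mult_nonneg_nonneg assms)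

text \<open>Nonnegative terms cannot cancel, so positivity only records whether a walk exists. In
  relational form, concatenating walks is \<open>relpow_add\<close>.\<close>

lemma n_step_pos_iff_relpow:
  assumes nonneg: "\<And>x x'. K x x' \<ge> 0"
  shows "n_step K n x x' > 0 \<longleftrightarrow> (x, x') \<in> {(x, x'). K x x' > 0} ^^ n"
proof (induction n arbitrary: x')
  case (Suc n)
  have "n_step K (Suc n) x x' > 0 \<longleftrightarrow> (\<exists>z. n_step K n x z * K z x' > 0)"
    using sum_nonneg_eq_0_iff[of UNIV "\<lambda>z. n_step K n x z * K z x'"]
      sum_nonneg[of UNIV "\<lambda>z. n_step K n x z * K z x'"] n_step_nonneg[of K n x, OF nonneg] nonneg
    by (simp add: less_le)
  also have "\<dots> \<longleftrightarrow> (\<exists>z. n_step K n x z > 0 \<and> K z x' > 0)"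
    using n_step_nonneg[of K n x, OF nonneg] nonneg by (auto simp: less_le)
  finally show ?case using Suc.IH by auto
qed auto

text \<open>Every walk is routed through a fixed state \<open>x0\<close>, where a loop of any large
  enough length is available to pad all walks to one common length.\<close>

lemma irreducible_aperiodic_imp_primitive:
  fixes K :: "'a::finite \<Rightarrow> 'a \<Rightarrow> real"
  assumes nonneg: "\<And>x x'. K x x' \<ge> 0" and "irreducible_kernel K" "aperiodic_kernel K"
  shows "\<exists>N. \<forall>x x'. n_step K N x x' > 0"
proof -
  define R where "R = {(x, x'). K x x' > 0}"
  have step: "n_step K n x x' > 0 \<longleftrightarrow> (x, x') \<in> R ^^ n" for n x x'
    unfolding R_def by (rule n_step_pos_iff_relpow) (rule nonneg)
  have irr: "\<exists>n. (x, x') \<in> R ^^ n" for x x'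
    using \<open>irreducible_kernel K\<close> unfolding irreducible_kernel_def step by blast
  fix x0 :: 'a
  let ?S = "{n. n > 0 \<and> (x0, x0) \<in> R ^^ n}"
  have "Gcd ?S = 1"
    using \<open>aperiodic_kernel K\<close> unfolding aperiodic_kernel_def step by blast
  then obtain M where M: "\<And>m. m \<ge> M \<Longrightarrow> (x0, x0) \<in> R ^^ m"
    using add_closed_Gcd_1_cofinite[of ?S] by (auto simp: relpow_add)
  have "\<exists>a. \<forall>x. (x, x0) \<in> R ^^ a x" "\<exists>b. \<forall>x. (x0, x) \<in> R ^^ b x"
    by (intro choice allI irr)+
  then obtain a b where a: "\<And>x. (x, x0) \<in> R ^^ a x" and b: "\<And>x. (x0, x) \<in> R ^^ b x"
    by blast
  \<comment> \<open>Large enough that, after the legs to and from \<open>x0\<close>, at least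
    \<open>M\<close> steps remain for the loop, uniformly in both endpoints.\<close>
  let ?N = "M + Max (range a) + Max (range b)"
  have "(x, x') \<in> R ^^ ?N" for x x'
  proof -
    have le: "a x \<le> Max (range a)" "b x' \<le> Max (range b)" by simp_all
    define m where "m = ?N - a x - b x'"
    have "m \<ge> M" and N: "?N = a x + m + b x'" unfolding m_def using le by linarith+
    then show ?thesis unfolding N relpow_add using a b M by blast
  qed
  then show ?thesis by (auto simp: step)
qed

section \<open>Half-steps, compatibility and supports\<close>

lemma map_fst_half_step_x [simp]: "map_pmf fst (half_step_x P \<pi>) = map_pmf fst \<pi>"
  by (simp add: half_step_x_def map_bind_pmf pmf.map_comp o_def bind_return_pmf')

text \<open>Exchanging the coordinates lets \<open>compat_y_iff_fixed\<close> be inherited from the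
  x-version.\<close>

lemma half_step_y_swap:
  "half_step_y Q \<pi> = map_pmf prod.swap (half_step_x Q (map_pmf prod.swap \<pi>))"
  by (simp add: half_step_x_def half_step_y_def map_bind_pmf pmf.map_comp o_def)

lemma map_snd_half_step_y [simp]: "map_pmf snd (half_step_y Q \<pi>) = map_pmf snd \<pi>"
  by (simp add: half_step_y_def map_bind_pmf pmf.map_comp o_def bind_return_pmf')

lemma set_half_step_x: "set_pmf (half_step_x P \<pi>) = {(x, y). x \<in> fst ` set_pmf \<pi> \<and> y \<in> set_pmf (P x)}"
  by (auto simp: half_step_x_def)

lemma set_half_step_y: "set_pmf (half_step_y Q \<pi>) = {(x, y). y \<in> snd ` set_pmf \<pi> \<and> x \<in> set_pmf (Q y)}"
  by (auto simp: half_step_y_def)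

text \<open>On singleton rectangles, compatibility is the pointwise formula of the half-step;
  summing over points recovers all rectangles.\<close>

lemma compat_x_iff_fixed: "compat_x P \<pi> \<longleftrightarrow> half_step_x P \<pi> = \<pi>"
proof
  assume *: "compat_x P \<pi>"
  have "pmf (half_step_x P \<pi>) (x, y) = pmf \<pi> (x, y)" for x y
    using *[unfolded compat_x_def, rule_format, of "{x}" "{y}"]
    by (simp add: pmf_half_step_x measure_pmf_single)
  then show "half_step_x P \<pi> = \<pi>" by (intro pmf_eqI) auto
next
  assume *: "half_step_x P \<pi> = \<pi>"
  show "compat_x P \<pi>"
    unfolding compat_x_def
  proof (intro allI)
    fix A B
    have "measure_pmf.prob \<pi> (A \<times> B) = (\<Sum>(x, y)\<in>A \<times> B. pmf (half_step_x P \<pi>) (x, y))"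
      by (simp add: measure_measure_pmf_finite * case_prod_unfold)
    also have "\<dots> = (\<Sum>x\<in>A. measure_pmf.prob (P x) B * pmf (map_pmf fst \<pi>) x)"
      by (simp add: pmf_half_step_x measure_measure_pmf_finite sum_distrib_right
          flip: sum.cartesian_product)
    finally show "measure_pmf.prob \<pi> (A \<times> B) =
      (\<Sum>x\<in>A. measure_pmf.prob (P x) B * pmf (map_pmf fst \<pi>) x)" .
  qed
qed

lemma compat_y_swap: "compat_y Q \<pi> \<longleftrightarrow> compat_x Q (map_pmf prod.swap \<pi>)"
proof -
  have "prod.swap -` (B \<times> A) = A \<times> B" for A :: "'b set" and B :: "'a set" by auto
  then show ?thesis
    by (auto simp: compat_x_def compat_y_def pmf.map_comp o_def)
qed

lemma compat_y_iff_fixed: "compat_y Q \<pi> \<longleftrightarrow> half_step_y Q \<pi> = \<pi>"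
proof -
  have "map_pmf prod.swap (map_pmf prod.swap \<pi>) = \<pi>" for \<pi> :: "('c \<times> 'd) pmf"
    by (simp add: pmf.map_comp o_def)
  then show ?thesis
    unfolding compat_y_swap compat_x_iff_fixed half_step_y_swap by metis
qed

section \<open>Supports along the chain\<close>

lemma primal_kernel_nonneg: "primal_kernel P Q x x' \<ge> 0"
  by (simp add: primal_kernel_def sum_nonneg)

lemma primal_kernel_pos_iff:
  "primal_kernel P Q x x' > 0 \<longleftrightarrow> (\<exists>y\<in>set_pmf (P x). x' \<in> set_pmf (Q y))"
proof -
  have "primal_kernel P Q x x' = 0 \<longleftrightarrow> (\<forall>y. pmf (P x) y * pmf (Q y) x' = 0)"
    unfolding primal_kernel_def by (subst sum_nonneg_eq_0_iff) auto
  then show ?thesis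
    using primal_kernel_nonneg[of P Q x x'] by (auto simp: less_le pmf_eq_0_set_pmf)
qed

text \<open>One primal step is an x-half-step followed by a y-half-step, starting at an even time;
  hence the index \<open>2 * n\<close>.\<close>

lemma n_step_primal_kernel_support:
  assumes "x \<in> fst ` set_pmf \<pi>0" "n_step (primal_kernel P Q) n x x' > 0"
  shows "x' \<in> fst ` set_pmf (product_chain P Q \<pi>0 (2 * n))"
  using assms(2) unfolding n_step_pos_iff_relpow[OF primal_kernel_nonneg]
proof (induction n arbitrary: x')
  case 0
  then show ?case using assms(1) by simp
next
  case (Suc n)
  from Suc.prems obtain z where "(x, z) \<in> {(x, x'). primal_kernel P Q x x' > 0} ^^ n"
    and "primal_kernel P Q z x' > 0" by auto
  with Suc.IH obtain y where "z \<in> fst ` set_pmf (product_chain P Q \<pi>0 (2 * n))"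
    and "y \<in> set_pmf (P z)" "x' \<in> set_pmf (Q y)"
    unfolding primal_kernel_pos_iff by blast
  then show ?case by (force simp: set_half_step_x set_half_step_y)
qed

text \<open>A compatible law is fixed by both half-steps, so the chain started from it is constant.
  Its X-support is then closed under the primal kernel, and irreducibility makes it
  everything.\<close>

lemma compat_support:
  assumes "irreducible_kernel (primal_kernel P Q)" "compat_x P \<pi>" "compat_y Q \<pi>"
    and snd: "set_pmf (map_pmf snd \<pi>) = UNIV"
  shows "set_pmf \<pi> = {(x, y). y \<in> set_pmf (P x)}" (is ?P)
    and "set_pmf \<pi> = {(x, y). x \<in> set_pmf (Q y)}" (is ?Q)
    and "fst ` set_pmf \<pi> = UNIV" (is ?F)
proof -
  have hx: "half_step_x P \<pi> = \<pi>" and hy: "half_step_y Q \<pi> = \<pi>"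
    using assms by (simp_all add: compat_x_iff_fixed compat_y_iff_fixed)
  show ?Q using set_half_step_y[of Q \<pi>] hy snd by simp
  have chain: "product_chain P Q \<pi> t = \<pi>" for t
    by (induction t) (simp_all add: hx hy)
  obtain x where x: "x \<in> fst ` set_pmf \<pi>" using set_pmf_not_empty[of \<pi>] by blast
  show ?F
    using n_step_primal_kernel_support[OF x, of P Q] assms(1)
    unfolding chain irreducible_kernel_def by blast
  then show ?P using set_half_step_x[of P \<pi>] hx by simp
qed

lemma product_chain_support:
  assumes irr: "irreducible_kernel (primal_kernel P Q)" and "aperiodic_kernel (primal_kernel P Q)"
    and "compat_x P \<pi>" "compat_y Q \<pi>" and snd: "set_pmf (map_pmf snd \<pi>) = UNIV"
    and T: "T = set_pmf \<pi>" and t: "t \<ge> burn_in_time P Q T"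
  shows "set_pmf (product_chain P Q \<pi>0 t) = T"
proof -
  note supp = compat_support[OF irr assms(3,4) snd, folded T]
  obtain N where N: "\<And>x x'. n_step (primal_kernel P Q) N x x' > 0"
    using irreducible_aperiodic_imp_primitive[OF primal_kernel_nonneg irr assms(2)] by blast
  \<comment> \<open>After \<open>2 * N\<close> half-steps the X-marginal has full support; the next
    half-step, at an even time, is an x-half-step and spreads it over all of \<open>T\<close>. The
    time does not depend on the initial law, so the \<open>LEAST\<close> in
    \<open>burn_in_time\<close> is attained.\<close>
  have "set_pmf (product_chain P Q \<pi>1 (Suc (2 * N))) = T" for \<pi>1
  proof -
    obtain x where "x \<in> fst ` set_pmf \<pi>1" using set_pmf_not_empty[of \<pi>1] by blast
    from n_step_primal_kernel_support[OF this N]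
    have "fst ` set_pmf (product_chain P Q \<pi>1 (2 * N)) = UNIV" by blast
    then show ?thesis by (simp add: set_half_step_x supp(1))
  qed
  then have "\<exists>t. \<forall>\<pi>1. set_pmf (product_chain P Q \<pi>1 t) = T" by blast
  then have "\<forall>\<pi>1. set_pmf (product_chain P Q \<pi>1 (burn_in_time P Q T)) = T"
    unfolding burn_in_time_def by (rule LeastI_ex)
  then have base: "set_pmf (product_chain P Q \<pi>0 (burn_in_time P Q T)) = T" ..
  from t show ?thesis
  proof (induction t rule: dec_induct)
    case (step t)
    \<comment> \<open>Both projections of \<open>T\<close> are full, so either kind of half-step
      maps support \<open>T\<close> to support \<open>T\<close>.\<close>
    have "snd ` T = UNIV" using snd T by simp
    then show ?case
      using step.IH supp by (auto simp: set_half_step_x set_half_step_y)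
  qed (fact base)
qed

section \<open>Projections\<close>

lemma sum_pmf_full_dists:
  fixes p :: "'a::finite pmf"
  assumes "p \<in> full_dists T"
  shows "(\<Sum>\<tau>\<in>T. pmf p \<tau>) = 1"
  using assms by (intro sum_pmf_eq_1) (auto simp: full_dists_def)

lemma full_dists_pos: "p \<in> full_dists T \<Longrightarrow> \<tau> \<in> T \<Longrightarrow> pmf p \<tau> > 0"
  by (auto simp: full_dists_def pmf_positive)

lemma D_KL_gibbs:
  fixes p q :: "'a::finite pmf"
  assumes p: "p \<in> full_dists T" and q: "q \<in> full_dists T"
  shows "D_KL T p q \<ge> 0" and "D_KL T p q = 0 \<longleftrightarrow> p = q"
proof -
  \<comment> \<open>The divergence summand plus \<open>q - p\<close>, whose total is zero. Each term
    is now nonnegative by \<open>ln u \<le> u - 1\<close>, with equality only at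
    \<open>u = 1\<close>.\<close>
  define g where "g = (\<lambda>\<tau>. pmf p \<tau> * (pmf q \<tau> / pmf p \<tau> - 1 - ln (pmf q \<tau> / pmf p \<tau>)))"
  have g0: "g \<tau> \<ge> 0" if "\<tau> \<in> T" for \<tau>
    using full_dists_pos[OF p that] full_dists_pos[OF q that]
      ln_le_minus_one[of "pmf q \<tau> / pmf p \<tau>"] by (simp add: g_def)
  have "g \<tau> = pmf q \<tau> - pmf p \<tau> + pmf p \<tau> * ln (pmf p \<tau> / pmf q \<tau>)" if "\<tau> \<in> T" for \<tau>
    using full_dists_pos[OF p that] full_dists_pos[OF q that]
    by (simp add: g_def ln_div algebra_simps)
  then have D: "D_KL T p q = (\<Sum>\<tau>\<in>T. g \<tau>)"
    by (simp add: D_KL_def sum.distrib sum_subtractf sum_pmf_full_dists[OF p] sum_pmf_full_dists[OF q])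
  show "D_KL T p q \<ge> 0" unfolding D by (intro sum_nonneg g0)
  show "D_KL T p q = 0 \<longleftrightarrow> p = q"
  proof
    assume "D_KL T p q = 0"
    then have "\<forall>\<tau>\<in>T. g \<tau> = 0"
      unfolding D by (subst (asm) sum_nonneg_eq_0_iff) (simp_all add: g0)
    then have "pmf p \<tau> = pmf q \<tau>" if "\<tau> \<in> T" for \<tau>
      using that full_dists_pos[OF p that] full_dists_pos[OF q that]
        ln_eq_minus_one[of "pmf q \<tau> / pmf p \<tau>"] by (auto simp: g_def)
    moreover have "pmf p \<tau> = pmf q \<tau>" if "\<tau> \<notin> T" for \<tau>
      using that p q by (auto simp: full_dists_def set_pmf_iff)
    ultimately show "p = q" by (intro pmf_eqI) blast
  next
    assume "p = q"
    then show "D_KL T p q = 0"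
      by (simp add: D_KL_def pmf_eq_0_set_pmf) (use q in \<open>auto simp: full_dists_def intro!: sum.neutral\<close>)
  qed
qed

text \<open>\<open>p\<close> and \<open>r\<close> share the factor \<open>k\<close>, the conditional
  law given \<open>f\<close>, so their ratio depends on \<open>f\<close> alone. Splitting
  \<open>q/p\<close> into \<open>q/r\<close> times \<open>r/p\<close> leaves a second term that sees
  \<open>q\<close> only through its image under \<open>f\<close>.\<close>

lemma D_KL_pythagoras:
  fixes p q r :: "'a::finite pmf" and f :: "'a \<Rightarrow> 'b::finite"
  assumes p: "p \<in> full_dists T" and q: "q \<in> full_dists T" and r: "r \<in> full_dists T"
    and pk: "\<And>\<tau>. pmf p \<tau> = k \<tau> * pmf (map_pmf f p) (f \<tau>)"
    and rk: "\<And>\<tau>. pmf r \<tau> = k \<tau> * pmf (map_pmf f q) (f \<tau>)"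
  shows "D_KL T q p = D_KL T q r + D_KL (f ` T) (map_pmf f q) (map_pmf f p)"
proof -
  let ?g = "\<lambda>b. ln (pmf (map_pmf f q) b / pmf (map_pmf f p) b)"
  have "pmf q \<tau> * ln (pmf q \<tau> / pmf p \<tau>) = pmf q \<tau> * ln (pmf q \<tau> / pmf r \<tau>) + pmf q \<tau> * ?g (f \<tau>)"
    if \<tau>: "\<tau> \<in> T" for \<tau>
  proof -
    note pos = full_dists_pos[OF p \<tau>] full_dists_pos[OF q \<tau>] full_dists_pos[OF r \<tau>]
    have "k \<tau> \<noteq> 0" "pmf (map_pmf f q) (f \<tau>) > 0" "pmf (map_pmf f p) (f \<tau>) > 0"
      using pos pk[of \<tau>] rk[of \<tau>] by (auto simp: less_le)
    then have "?g (f \<tau>) = ln (pmf r \<tau> / pmf p \<tau>)"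
      unfolding pk[of \<tau>] rk[of \<tau>] by simp
    moreover have "ln (pmf q \<tau> / pmf p \<tau>) = ln (pmf q \<tau> / pmf r \<tau>) + ln (pmf r \<tau> / pmf p \<tau>)"
      using pos by (simp add: ln_div)
    ultimately show ?thesis by (simp add: distrib_left)
  qed
  then have "D_KL T q p = D_KL T q r + (\<Sum>\<tau>\<in>T. pmf q \<tau> * ?g (f \<tau>))"
    by (simp add: D_KL_def sum.distrib)
  also have "(\<Sum>\<tau>\<in>T. pmf q \<tau> * ?g (f \<tau>)) = measure_pmf.expectation (map_pmf f q) ?g"
    unfolding integral_map_pmf
    by (subst integral_measure_pmf[of T]) (use q in \<open>auto simp: full_dists_def\<close>)
  also have "\<dots> = D_KL (f ` T) (map_pmf f q) (map_pmf f p)"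
    unfolding D_KL_def
    by (subst integral_measure_pmf[of "f ` T"]) (use q in \<open>auto simp: full_dists_def\<close>)
  finally show ?thesis .
qed

section \<open>Unique minimizers for the two divergences\<close>

lemma unique_argmin_iff:
  "unique_argmin f S x \<longleftrightarrow> x \<in> S \<and> (\<forall>y\<in>S. y \<noteq> x \<longrightarrow> f x < f y)"
proof
  assume x: "unique_argmin f S x"
  then have min: "f x \<le> f z" if "z \<in> S" for z
    using that by (auto simp: unique_argmin_def is_arg_min_def not_less)
  have "f x < f y" if y: "y \<in> S" "y \<noteq> x" for y
  proof (rule ccontr)
    assume "\<not> f x < f y"
    \<comment> \<open>A competitor with no larger value would itself be a minimizer, against
      uniqueness.\<close>
    then have "f y \<le> f z" if "z \<in> S" for z using min[OF that] by linarith
    then have "is_arg_min f (\<lambda>y. y \<in> S) y"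
      using y by (simp add: is_arg_min_def not_less)
    with x y show False by (simp add: unique_argmin_def)
  qed
  with x show "x \<in> S \<and> (\<forall>y\<in>S. y \<noteq> x \<longrightarrow> f x < f y)"
    by (simp add: unique_argmin_def is_arg_min_def)
next
  assume "x \<in> S \<and> (\<forall>y\<in>S. y \<noteq> x \<longrightarrow> f x < f y)"
  then show "unique_argmin f S x"
    by (auto simp: unique_argmin_def is_arg_min_def dest: less_asym)
qed

lemma unique_argmin_D_RKL:
  fixes q r :: "'a::finite pmf" and f :: "'a \<Rightarrow> 'b::finite"
  assumes S: "S \<subseteq> full_dists T" and q: "q \<in> full_dists T" and r: "r \<in> S"
    and Sk: "\<And>p \<tau>. p \<in> S \<Longrightarrow> pmf p \<tau> = k \<tau> * pmf (map_pmf f p) (f \<tau>)"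
    and rk: "\<And>\<tau>. pmf r \<tau> = k \<tau> * pmf (map_pmf f q) (f \<tau>)"
  shows "unique_argmin (\<lambda>p. D_RKL T p q) S r"
  unfolding unique_argmin_iff
proof (intro conjI ballI impI r)
  fix p assume p: "p \<in> S" "p \<noteq> r"
  \<comment> \<open>An element of \<open>S\<close> is determined by its image under
    \<open>f\<close>; sharing that of \<open>q\<close> would make it \<open>r\<close>.\<close>
  have "map_pmf f q \<noteq> map_pmf f p"
    using p Sk[OF p(1)] rk by (metis pmf_eqI)
  moreover have "map_pmf f p \<in> full_dists (f ` T)" "map_pmf f q \<in> full_dists (f ` T)"
    using S p q by (auto simp: full_dists_def)
  ultimately have "D_KL (f ` T) (map_pmf f q) (map_pmf f p) > 0"
    using D_KL_gibbs by (metis less_le)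
  moreover have "p \<in> full_dists T" "r \<in> full_dists T" using S p r by auto
  ultimately show "D_RKL T r q < D_RKL T p q"
    unfolding D_RKL_def using D_KL_pythagoras[OF _ q _ Sk[OF p(1)] rk] by auto
qed

text \<open>Exponentials undo the logarithms, and since \<open>p\<close> and \<open>q\<close> have
  mass 1 the scale \<open>c\<close> separates from the shape \<open>p\<close>.\<close>

lemma bregman_log_vec_cone:
  fixes p q :: "'a::finite pmf"
  assumes p: "p \<in> full_dists T" and q: "q \<in> full_dists T" and "c > 0"
  shows "bregman T (H_star T) (log_vec T (restrict (\<lambda>\<tau>. c * pmf p \<tau>) T)) (log_vec T (pmf q))
    = D_RKL T p q + (c - 1 - ln c)"
proof -
  have "bregman T (H_star T) (log_vec T (restrict (\<lambda>\<tau>. c * pmf p \<tau>) T)) (log_vec T (pmf q)) =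
      (\<Sum>\<tau>\<in>T. c * pmf p \<tau> - (1 + ln c) * pmf q \<tau> + pmf q \<tau> * ln (pmf q \<tau> / pmf p \<tau>))"
    unfolding bregman_H_star[OF finite] log_vec_def
  proof (intro sum.cong refl)
    fix \<tau> assume \<tau>: "\<tau> \<in> T"
    show "exp (restrict (\<lambda>\<tau>. ln (restrict (\<lambda>\<tau>. c * pmf p \<tau>) T \<tau>)) T \<tau>)
      - exp (restrict (\<lambda>\<tau>. ln (pmf q \<tau>)) T \<tau>)
      - exp (restrict (\<lambda>\<tau>. ln (pmf q \<tau>)) T \<tau>) *
        (restrict (\<lambda>\<tau>. ln (restrict (\<lambda>\<tau>. c * pmf p \<tau>) T \<tau>)) T \<tau> - restrict (\<lambda>\<tau>. ln (pmf q \<tau>)) T \<tau>) =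
      c * pmf p \<tau> - (1 + ln c) * pmf q \<tau> + pmf q \<tau> * ln (pmf q \<tau> / pmf p \<tau>)"
      using \<tau> full_dists_pos[OF p \<tau>] full_dists_pos[OF q \<tau>] \<open>c > 0\<close>
      by (simp add: exp_add ln_div ln_mult algebra_simps)
  qed
  also have "\<dots> = D_RKL T p q + (c - 1 - ln c)"
    by (simp add: D_RKL_def D_KL_def sum.distrib sum_subtractf
        sum_pmf_full_dists[OF p] sum_pmf_full_dists[OF q] flip: sum_distrib_left)
  finally show ?thesis .
qed

lemma unique_argmin_bregman:
  fixes q r :: "'a::finite pmf"
  assumes S: "S \<subseteq> full_dists T" and q: "q \<in> full_dists T"
    and r: "unique_argmin (\<lambda>p. D_RKL T p q) S r"
  shows "unique_argmin (\<lambda>v. bregman T (H_star T) v (log_vec T (pmf q)))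
    (log_vec T ` cone_of T S) (log_vec T (pmf r))"
  unfolding unique_argmin_iff
proof (intro conjI ballI impI)
  have rS: "r \<in> S" using r by (simp add: unique_argmin_iff)
  \<comment> \<open>Scale 1 exhibits \<open>r\<close> as a cone element and puts it in the form
    required by \<open>bregman_log_vec_cone\<close>.\<close>
  have r1: "log_vec T (pmf r) = log_vec T (restrict (\<lambda>\<tau>. 1 * pmf r \<tau>) T)"
    by (auto simp: log_vec_def)
  have "restrict (\<lambda>\<tau>. 1 * pmf r \<tau>) T \<in> cone_of T S"
    unfolding cone_of_def using rS zero_less_one by blast
  then show "log_vec T (pmf r) \<in> log_vec T ` cone_of T S"
    unfolding r1 by (rule imageI)
  fix v assume "v \<in> log_vec T ` cone_of T S" and ne: "v \<noteq> log_vec T (pmf r)"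
  then obtain c p where v: "v = log_vec T (restrict (\<lambda>\<tau>. c * pmf p \<tau>) T)" and c: "c > 0" and p: "p \<in> S"
    by (auto simp: cone_of_def)
  have "ln c \<le> c - 1" "c \<noteq> 1 \<Longrightarrow> ln c \<noteq> c - 1"
    using ln_le_minus_one[OF c] ln_eq_minus_one[OF c] by auto
  moreover have "p \<noteq> r \<Longrightarrow> D_RKL T r q < D_RKL T p q"
    using r p by (simp add: unique_argmin_iff)
  \<comment> \<open>A different shape costs strictly more divergence; the same shape forces
    \<open>c \<noteq> 1\<close>, where the scale term is positive.\<close>
  moreover have "c \<noteq> 1 \<or> p \<noteq> r" using ne v r1 by auto
  ultimately have "D_RKL T r q < D_RKL T p q + (c - 1 - ln c)"
    by (cases "p = r") auto
  moreover have "bregman T (H_star T) (log_vec T (pmf r)) (log_vec T (pmf q)) = D_RKL T r q"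
    unfolding r1 using bregman_log_vec_cone[of r T q 1] S rS q by auto
  moreover have "bregman T (H_star T) v (log_vec T (pmf q)) = D_RKL T p q + (c - 1 - ln c)"
    unfolding v using bregman_log_vec_cone[OF _ q c] S p by blast
  ultimately show "bregman T (H_star T) (log_vec T (pmf r)) (log_vec T (pmf q))
      < bregman T (H_star T) v (log_vec T (pmf q))"
    by simp
qed

section \<open>Half-steps as projections\<close>

lemma half_step_x_projection:
  fixes P :: "'x::finite \<Rightarrow> 'y::finite pmf"
  assumes "q \<in> full_dists T" "half_step_x P q \<in> full_dists T"
  shows "unique_argmin (\<lambda>p. D_RKL T p q) (S1 P T) (half_step_x P q)"
proof (rule unique_argmin_D_RKL[where f = fst and k = "\<lambda>(x, y). pmf (P x) y"])
  \<comment> \<open>The first marginal is preserved, so the half-step is idempotent and its result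
    is compatible.\<close>
  have "half_step_x P (half_step_x P q) = half_step_x P q"
    by (rule pmf_eqI) (auto simp: pmf_half_step_x)
  with assms show "half_step_x P q \<in> S1 P T"
    by (simp add: S1_def compat_x_iff_fixed)
  show "pmf p \<tau> = (case \<tau> of (x, y) \<Rightarrow> pmf (P x) y) * pmf (map_pmf fst p) (fst \<tau>)"
    if "p \<in> S1 P T" for p \<tau>
    using that pmf_half_step_x[of P p "fst \<tau>" "snd \<tau>"]
    by (simp add: S1_def compat_x_iff_fixed case_prod_unfold)
qed (use assms in \<open>auto simp: S1_def pmf_half_step_x\<close>)

lemma half_step_y_projection:
  fixes Q :: "'y::finite \<Rightarrow> 'x::finite pmf"
  assumes "q \<in> full_dists T" "half_step_y Q q \<in> full_dists T"
  shows "unique_argmin (\<lambda>p. D_RKL T p q) (S2 Q T) (half_step_y Q q)"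
proof (rule unique_argmin_D_RKL[where f = snd and k = "\<lambda>(x, y). pmf (Q y) x"])
  have "half_step_y Q (half_step_y Q q) = half_step_y Q q"
    by (rule pmf_eqI) (auto simp: pmf_half_step_y)
  with assms show "half_step_y Q q \<in> S2 Q T"
    by (simp add: S2_def compat_y_iff_fixed)
  show "pmf p \<tau> = (case \<tau> of (x, y) \<Rightarrow> pmf (Q y) x) * pmf (map_pmf snd p) (snd \<tau>)"
    if "p \<in> S2 Q T" for p \<tau>
    using that pmf_half_step_y[of Q p "fst \<tau>" "snd \<tau>"]
    by (simp add: S2_def compat_y_iff_fixed case_prod_unfold)
qed (use assms in \<open>auto simp: S2_def pmf_half_step_y\<close>)

theorem theorem1p7:
  fixes P :: "'x::finite \<Rightarrow> 'y::finite pmf"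
    and Q :: "'y \<Rightarrow> 'x pmf"
    and \<pi>ES :: "('x \<times> 'y) pmf"
    and T :: "('x \<times> 'y) set"
    and \<pi>0 :: "('x \<times> 'y) pmf"
    and \<pi> :: "nat \<Rightarrow> ('x \<times> 'y) pmf"
    and l :: "nat \<Rightarrow> 'x \<times> 'y \<Rightarrow> real"
  assumes "irreducible_kernel (primal_kernel P Q)"
    and "aperiodic_kernel (primal_kernel P Q)"
    and "compat_x P \<pi>ES" and "compat_y Q \<pi>ES"
    and "set_pmf (map_pmf snd \<pi>ES) = UNIV"
    and T: "T = set_pmf \<pi>ES"
    and \<pi>: "\<And>t. \<pi> t = product_chain P Q \<pi>0 t"
    and l: "\<And>t. l t = log_vec T (pmf (\<pi> t))"
  shows "\<forall>t \<ge> burn_in_time P Q T.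
    (even t \<longrightarrow>
       unique_argmin (\<lambda>p. D_RKL T p (\<pi> t)) (S1 P T) (\<pi> (t + 1)) \<and>
       unique_argmin (\<lambda>v. bregman T (H_star T) v (l t))
         (log_vec T ` cone_of T (S1 P T)) (l (t + 1))) \<and>
    (odd t \<longrightarrow>
       unique_argmin (\<lambda>p. D_RKL T p (\<pi> t)) (S2 Q T) (\<pi> (t + 1)) \<and>
       unique_argmin (\<lambda>v. bregman T (H_star T) v (l t))
         (log_vec T ` cone_of T (S2 Q T)) (l (t + 1)))"
proof (intro allI impI conjI)
  fix t assume t: "t \<ge> burn_in_time P Q T"
  \<comment> \<open>Stated for all later times because both the projected point, at
    \<open>t\<close>, and its projection, at \<open>t + 1\<close>, must have full support.\<close>
  have "set_pmf (\<pi> s) = T" if "s \<ge> burn_in_time P Q T" for s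
    unfolding \<pi> using product_chain_support[OF assms(1-5) T that] .
  with t have full: "\<pi> t \<in> full_dists T" "\<pi> (t + 1) \<in> full_dists T"
    by (simp_all add: full_dists_def)
  have S: "S1 P T \<subseteq> full_dists T" "S2 Q T \<subseteq> full_dists T"
    by (auto simp: S1_def S2_def)
  show x: "unique_argmin (\<lambda>p. D_RKL T p (\<pi> t)) (S1 P T) (\<pi> (t + 1))" if "even t"
  proof -
    have "\<pi> (t + 1) = half_step_x P (\<pi> t)" using that by (simp add: \<pi>)
    with full show ?thesis using half_step_x_projection by metis
  qed
  show y: "unique_argmin (\<lambda>p. D_RKL T p (\<pi> t)) (S2 Q T) (\<pi> (t + 1))" if "odd t"
  proof -
    have "\<pi> (t + 1) = half_step_y Q (\<pi> t)" using that by (simp add: \<pi>)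
    with full show ?thesis using half_step_y_projection by metis
  qed
  show "unique_argmin (\<lambda>v. bregman T (H_star T) v (l t))
      (log_vec T ` cone_of T (S1 P T)) (l (t + 1))" if "even t"
    unfolding l by (rule unique_argmin_bregman[OF S(1) full(1) x[OF that]])
  show "unique_argmin (\<lambda>v. bregman T (H_star T) v (l t))
      (log_vec T ` cone_of T (S2 Q T)) (l (t + 1))" if "odd t"
    unfolding l by (rule unique_argmin_bregman[OF S(2) full(1) y[OF that]])
qed

end
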